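(* Let $H\in\mathbb{R}^{n\times n}$ be self-adjoint, $h\in\mathbb{R}^n$, $f(x)=\tfrac12\langle Hx,x\rangle+\langle h,x\rangle$, and let $g:\mathbb{R}^n\to\mathbb{R}\cup\{\infty\}$ be proper, closed and convex. Let $L=\lambda_{\max}(H)$, $\gamma\in(0,\tfrac1L)$, and suppose that $m=\lambda_{\min}(H)\ge0$. Then the Douglas-Rachford envelope $F_\gamma^{\mathrm{DR}}$ (defined in the context) is $\tfrac{1-\gamma m}{(1+\gamma m)^2}\gamma^{-1}$-smooth and $\min\Big(\tfrac{(1-\gamma m)m}{(1+\gamma m)^2},\tfrac{(1-\gamma L)L}{(1+\gamma L)^2}\Big)$-strongly convex.
   Context: $\langle\cdot,\cdot\rangle$ is an inner product on $\mathbb{R}^n$ with induced norm $\|\cdot\|$. A differentiable $\phi:\mathbb{R}^n\to\mathbb{R}$ is $\beta$-smooth ($\beta\ge0$) if $-\tfrac\beta2\|x-y\|^2\le\phi(x)-\phi(y)-\langle\nabla\phi(y),x-y\rangle\le\tfrac\beta2\|x-y\|^2$ for all $x,y$. $\phi$ is $\sigma$-strongly convex if $\phi-\tfrac\sigma2\|\cdot\|^2$ is convex (for $\sigma=0$ this means $\phi$ is convex). The conjugate of $\phi$ is $\phi^*(y)=\sup_x\{\langle y,x\rangle-\phi(x)\}$. For a proper closed convex $\phi$ and $\gamma>0$: $\mathrm{prox}_{\gamma\phi}(z)=\operatorname{argmin}_x\{\phi(x)+\tfrac1{2\gamma}\|x-z\|^2\}$; $r_{\gamma\phi}(x)=\gamma\phi(x)+\tfrac12\|x\|^2$,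 whose conjugate satisfies $\nabla r_{\gamma\phi}^*=\mathrm{prox}_{\gamma\phi}$; $p_{\gamma\phi}^2(x)=2r_{\gamma\phi}^*(x)-\tfrac12\|x\|^2$; and $R_{\gamma\phi}=\nabla p_{\gamma\phi}^2=2\,\mathrm{prox}_{\gamma\phi}-\mathrm{Id}$. The Douglas-Rachford envelope is $$F_\gamma^{\mathrm{DR}}(z)=(2\gamma)^{-1}\big(\langle R_{\gamma f}(z),z\rangle-p_{\gamma f}^2(z)-p_{\gamma g}^2(R_{\gamma f}(z))\big).$$ If $L=0$, the interval $(0,1/L)$ is read as $(0,\infty)$. *)

theory Defs
  imports "HOL-Analysis.Analysis"
begin

text \<open>
  The space \<open>\<real>\<^sup>n\<close> with an arbitrary inner product is a type of class
  \<open>euclidean_space\<close>; its inner product and norm are used throughout.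
\<close>

definition eigenvalues :: "('a::real_vector \<Rightarrow> 'a) \<Rightarrow> real set" where
  "eigenvalues A = {l. \<exists>v. v \<noteq> 0 \<and> A v = l *\<^sub>R v}"

definition lambda_max :: "('a::real_vector \<Rightarrow> 'a) \<Rightarrow> real" where
  "lambda_max A = Max (eigenvalues A)"

definition lambda_min :: "('a::real_vector \<Rightarrow> 'a) \<Rightarrow> real" where
  "lambda_min A = Min (eigenvalues A)"

definition ext_epigraph :: "('a \<Rightarrow> ereal) \<Rightarrow> ('a \<times> real) set" where
  "ext_epigraph g = {(x, t). g x \<le> ereal t}"

definition proper_fun :: "('a \<Rightarrow> ereal) \<Rightarrow> bool" where
  "proper_fun g \<longleftrightarrow> (\<forall>x. g x \<noteq> -\<infinity>) \<and> (\<exists>x. g x \<noteq> \<infinity>)"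

definition closed_fun :: "('a::topological_space \<Rightarrow> ereal) \<Rightarrow> bool" where
  "closed_fun g \<longleftrightarrow> closed (ext_epigraph g)"

definition convex_fun :: "('a::real_vector \<Rightarrow> ereal) \<Rightarrow> bool" where
  "convex_fun g \<longleftrightarrow> convex (ext_epigraph g)"

definition beta_smooth :: "real \<Rightarrow> ('a::real_inner \<Rightarrow> real) \<Rightarrow> bool" where
  "beta_smooth \<beta> \<phi> \<longleftrightarrow> 0 \<le> \<beta> \<and>
     (\<exists>grad. (\<forall>y. GDERIV \<phi> y :> grad y) \<and>
       (\<forall>x y. - (\<beta> / 2) * (norm (x - y))\<^sup>2 \<le> \<phi> x - \<phi> y - grad y \<bullet> (x - y) \<and>
              \<phi> x - \<phi> y - grad y \<bullet> (x - y) \<le> (\<beta> / 2) * (norm (x - y))\<^sup>2))"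

definition strongly_convex :: "real \<Rightarrow> ('a::real_inner \<Rightarrow> real) \<Rightarrow> bool" where
  "strongly_convex \<sigma> \<phi> \<longleftrightarrow> convex_on UNIV (\<lambda>x. \<phi> x - (\<sigma> / 2) * (norm x)\<^sup>2)"

definition conjugate :: "('a::real_inner \<Rightarrow> ereal) \<Rightarrow> 'a \<Rightarrow> ereal" where
  "conjugate \<phi> y = (SUP x. ereal (y \<bullet> x) - \<phi> x)"

text \<open>For proper closed convex \<open>\<phi>\<close> and \<open>\<gamma> > 0\<close> the minimiser below exists and is unique.\<close>

definition prox :: "real \<Rightarrow> ('a::real_inner \<Rightarrow> ereal) \<Rightarrow> 'a \<Rightarrow> 'a" where
  "prox \<gamma> \<phi> z = arg_min (\<lambda>x. \<phi> x + ereal (1 / (2 * \<gamma>) * (norm (x - z))\<^sup>2)) (\<lambda>x. True)"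

definition r_fun :: "real \<Rightarrow> ('a::real_inner \<Rightarrow> ereal) \<Rightarrow> 'a \<Rightarrow> ereal" where
  "r_fun \<gamma> \<phi> x = ereal \<gamma> * \<phi> x + ereal (1 / 2 * (norm x)\<^sup>2)"

text \<open>\<open>p_sq \<gamma> \<phi>\<close> is the function written \<open>p\<^sup>2\<close> with subscript \<open>\<gamma>\<phi>\<close>; it is not the square of another function.\<close>

definition p_sq :: "real \<Rightarrow> ('a::real_inner \<Rightarrow> ereal) \<Rightarrow> 'a \<Rightarrow> ereal" where
  "p_sq \<gamma> \<phi> x = 2 * conjugate (r_fun \<gamma> \<phi>) x - ereal (1 / 2 * (norm x)\<^sup>2)"

definition refl_prox :: "real \<Rightarrow> ('a::real_inner \<Rightarrow> ereal) \<Rightarrow> 'a \<Rightarrow> 'a" where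
  "refl_prox \<gamma> \<phi> z = 2 *\<^sub>R prox \<gamma> \<phi> z - z"

definition DR_envelope ::
  "real \<Rightarrow> ('a::real_inner \<Rightarrow> ereal) \<Rightarrow> ('a \<Rightarrow> ereal) \<Rightarrow> 'a \<Rightarrow> ereal" where
  "DR_envelope \<gamma> f g z =
     ereal (1 / (2 * \<gamma>)) *
       (ereal (refl_prox \<gamma> f z \<bullet> z) - p_sq \<gamma> f z - p_sq \<gamma> g (refl_prox \<gamma> f z))"

end

theory Submission
  imports Defs
begin

text \<open>
  The map \<open>R = R\<^sub>\<gamma>\<^sub>f\<close> is affine with self-adjoint linear part \<open>A = (I - \<gamma>H)(I + \<gamma>H)\<^sup>-\<^sup>1\<close>, and
  \<open>\<langle>R z, z\<rangle> - p\<^sup>2\<^sub>\<gamma>\<^sub>f(z)\<close> is a quadratic with gradient \<open>A z\<close>. The first-order remainder of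
  \<open>r\<^sub>\<gamma>\<^sub>g\<^sup>*\<close> lies between \<open>0\<close> and half the squared distance because \<open>r\<^sub>\<gamma>\<^sub>g\<close> is 1-strongly convex.
  Hence the first-order remainder of the envelope for a displacement \<open>d\<close> lies between
  \<open>(\<langle>A d, d\<rangle> - \<parallel>A d\<parallel>\<^sup>2) / (4\<gamma>)\<close> and \<open>(\<langle>A d, d\<rangle> + \<parallel>A d\<parallel>\<^sup>2) / (4\<gamma>)\<close>. Substituting \<open>d = u + \<gamma>Hu\<close>, so
  that \<open>A d = u - \<gamma>Hu\<close>, avoids functional calculus: the bounds become inequalities between
  \<open>\<parallel>u\<parallel>\<^sup>2\<close>, \<open>\<langle>Hu, u\<rangle>\<close> and \<open>\<parallel>Hu\<parallel>\<^sup>2\<close>.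
\<close>

section \<open>Quadratic forms and extreme eigenvalues of self-adjoint maps\<close>

text \<open>For a bound d > 0, the nonnegative form at d u - M u produces the cubic term <M(Mu),
  Mu>. The upper bound at \<open>M u\<close> cancels it and leaves d times the claim.\<close>

lemma selfadjoint_norm_sq_le:
  fixes M :: "'a::real_inner \<Rightarrow> 'a"
  assumes lin: "linear M" and sym: "\<And>x y. M x \<bullet> y = x \<bullet> M y"
    and nonneg: "\<And>x. 0 \<le> M x \<bullet> x" and le: "\<And>x. M x \<bullet> x \<le> \<delta> * (x \<bullet> x)"
  shows "M u \<bullet> M u \<le> \<delta> * (M u \<bullet> u)"
proof -
  have main: "M u \<bullet> M u \<le> d * (M u \<bullet> u)" if "d > 0" and b: "\<And>x. M x \<bullet> x \<le> d * (x \<bullet> x)" for d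
  proof -
    have "0 \<le> M (d *\<^sub>R u - M u) \<bullet> (d *\<^sub>R u - M u) + (d * (M u \<bullet> M u) - M (M u) \<bullet> M u)"
      using nonneg[of "d *\<^sub>R u - M u"] b[of "M u"] by linarith
    also have "\<dots> = d * (d * (M u \<bullet> u) - M u \<bullet> M u)"
      using sym[of "M u" u]
      by (simp add: linear_diff[OF lin] linear_cmul[OF lin] inner_diff_left inner_diff_right
          algebra_simps)
    finally show ?thesis using \<open>d > 0\<close> by (simp add: zero_le_mult_iff)
  qed
  show ?thesis
  proof (cases "\<delta> > 0")
    case True
    then show ?thesis using main le by blast
  next
    \<comment> \<open>The form now vanishes identically, so d = 1 is also a bound and gives M u =
      0.\<close>
    case False
    then have zero: "M x \<bullet> x = 0" for x
      using nonneg[of x] le[of x] mult_nonpos_nonneg[of \<delta> "x \<bullet> x"] by simp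
    show ?thesis using main[of 1] by (simp add: zero)
  qed
qed

text \<open>The inequality says \<open>\<langle>(H - m)u, (L - H)u\<rangle> \<ge> 0\<close>.\<close>

lemma selfadjoint_product_nonneg:
  fixes H :: "'a::real_inner \<Rightarrow> 'a"
  assumes lin: "linear H" and sym: "\<And>x y. H x \<bullet> y = x \<bullet> H y"
    and ge: "\<And>x. m * (x \<bullet> x) \<le> H x \<bullet> x" and le: "\<And>x. H x \<bullet> x \<le> L * (x \<bullet> x)"
  shows "H u \<bullet> H u + m * L * (u \<bullet> u) \<le> (m + L) * (H u \<bullet> u)"
proof -
  let ?M = "\<lambda>x. H x - m *\<^sub>R x"
  have "?M u \<bullet> ?M u \<le> (L - m) * (?M u \<bullet> u)"
  proof (rule selfadjoint_norm_sq_le)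
    show "linear ?M"
      by (intro linear_compose_sub lin linear_compose_scale_right linear_id[unfolded id_def])
    show "?M x \<bullet> y = x \<bullet> ?M y" for x y
      by (simp add: sym inner_diff_left inner_diff_right)
    show "0 \<le> ?M x \<bullet> x" for x
      using ge[of x] by (simp add: inner_diff_left)
    show "?M x \<bullet> x \<le> (L - m) * (x \<bullet> x)" for x
      using le[of x] by (simp add: inner_diff_left algebra_simps)
  qed
  then show ?thesis
    by (simp add: inner_diff_left inner_diff_right inner_commute algebra_simps)
qed

text \<open>Eigenvectors for distinct eigenvalues are orthogonal, and a pairwise orthogonal set in
  Euclidean space is finite. This makes \<open>Max\<close> and \<open>Min\<close> actual bounds for
  the eigenvalues.\<close>

lemma finite_eigenvalues_selfadjoint:
  fixes H :: "'a::euclidean_space \<Rightarrow> 'a"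
  assumes sym: "\<And>x y. H x \<bullet> y = x \<bullet> H y"
  shows "finite (eigenvalues H)"
proof -
  have "\<exists>v. \<forall>l\<in>eigenvalues H. v l \<noteq> 0 \<and> H (v l) = l *\<^sub>R v l"
    by (rule bchoice) (auto simp: eigenvalues_def)
  then obtain v where v: "\<And>l. l \<in> eigenvalues H \<Longrightarrow> v l \<noteq> 0 \<and> H (v l) = l *\<^sub>R v l"
    by blast
  have orth: "v k \<bullet> v l = 0" if "k \<in> eigenvalues H" "l \<in> eigenvalues H" "k \<noteq> l" for k l
    using sym[of "v k" "v l"] v[OF that(1)] v[OF that(2)] that(3) by simp
  have inj: "inj_on v (eigenvalues H)"
  proof (rule inj_onI)
    fix k l assume "k \<in> eigenvalues H" "l \<in> eigenvalues H" "v k = v l"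
    then show "k = l" using orth[of k l] v[of k] by auto
  qed
  have "pairwise orthogonal (v ` eigenvalues H)"
    unfolding pairwise_def orthogonal_def using orth by auto
  then have "finite (v ` eigenvalues H)"
    by (rule pairwise_orthogonal_imp_finite)
  then show ?thesis using inj finite_imageD by blast
qed

text \<open>The form attains its maximum l over the unit sphere at some v. Then l - H is positive
  semidefinite with form zero at v, and \<open>selfadjoint_norm_sq_le\<close> forces (l - H) v =
  0.\<close>

lemma selfadjoint_maximal_eigenvalue:
  fixes H :: "'a::euclidean_space \<Rightarrow> 'a"
  assumes lin: "linear H" and sym: "\<And>x y. H x \<bullet> y = x \<bullet> H y"
  obtains l where "l \<in> eigenvalues H" and "\<And>x. H x \<bullet> x \<le> l * (x \<bullet> x)"
proof -
  have "continuous_on (sphere 0 1) (\<lambda>x. H x \<bullet> x)"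
    using lin by (intro continuous_on_inner continuous_on_id linear_continuous_on)
      (simp add: linear_conv_bounded_linear)
  then have "\<exists>v\<in>sphere 0 1. \<forall>x\<in>sphere 0 1. H x \<bullet> x \<le> H v \<bullet> v"
    by (intro continuous_attains_sup) auto
  then obtain v where v: "norm v = 1" "\<And>x. norm x = 1 \<Longrightarrow> H x \<bullet> x \<le> H v \<bullet> v"
    by auto
  define l where "l = H v \<bullet> v"
  have le: "H x \<bullet> x \<le> l * (x \<bullet> x)" for x
  proof (cases "x = 0")
    case False
    then have "H (x /\<^sub>R norm x) \<bullet> (x /\<^sub>R norm x) \<le> l"
      unfolding l_def by (intro v(2)) simp
    then show ?thesis using False
      by (simp add: linear_cmul[OF lin] dot_square_norm power2_eq_square field_simps)
  qed (simp add: linear_0[OF lin])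
  obtain B where B: "\<And>x. norm (H x) \<le> B * norm x"
    using linear_bounded[OF lin] by blast
  let ?M = "\<lambda>x. l *\<^sub>R x - H x"
  \<comment> \<open>By Cauchy-Schwarz l + B bounds the form of l - H; here it multiplies <(l - H) v,
    v> = 0.\<close>
  have "?M v \<bullet> ?M v \<le> (l + B) * (?M v \<bullet> v)"
  proof (rule selfadjoint_norm_sq_le)
    show "linear ?M"
      by (intro linear_compose_sub lin linear_compose_scale_right linear_id[unfolded id_def])
    show "?M x \<bullet> y = x \<bullet> ?M y" for x y
      by (simp add: sym inner_diff_left inner_diff_right)
    show "0 \<le> ?M x \<bullet> x" for x
      using le[of x] by (simp add: inner_diff_left)
    show "?M x \<bullet> x \<le> (l + B) * (x \<bullet> x)" for x
    proof -
      have "- (H x \<bullet> x) \<le> norm (H x) * norm x"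
        using Cauchy_Schwarz_ineq2[of "H x" x] by linarith
      also have "\<dots> \<le> B * norm x * norm x"
        by (intro mult_right_mono B) simp
      finally show ?thesis
        by (simp add: inner_diff_left dot_square_norm power2_eq_square algebra_simps)
    qed
  qed
  also have "?M v \<bullet> v = 0"
    using v(1) by (simp add: inner_diff_left dot_square_norm l_def)
  finally have "?M v \<bullet> ?M v \<le> 0" by simp
  then have "?M v \<bullet> ?M v = 0" by (rule antisym) simp
  then have "H v = l *\<^sub>R v" by simp
  moreover have "v \<noteq> 0" using v(1) by auto
  ultimately have "l \<in> eigenvalues H" unfolding eigenvalues_def by blast
  then show ?thesis using le that by blast
qed

lemma selfadjoint_le_lambda_max:
  fixes H :: "'a::euclidean_space \<Rightarrow> 'a"
  assumes lin: "linear H" and sym: "\<And>x y. H x \<bullet> y = x \<bullet> H y"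
  shows "H x \<bullet> x \<le> lambda_max H * (x \<bullet> x)"
proof -
  obtain l where l: "l \<in> eigenvalues H" "\<And>x. H x \<bullet> x \<le> l * (x \<bullet> x)"
    using selfadjoint_maximal_eigenvalue[OF assms] by blast
  have "l \<le> lambda_max H"
    unfolding lambda_max_def by (intro Max_ge finite_eigenvalues_selfadjoint sym l)
  then have "l * (x \<bullet> x) \<le> lambda_max H * (x \<bullet> x)"
    by (intro mult_right_mono) auto
  with l(2)[of x] show ?thesis by linarith
qed

lemma selfadjoint_ge_lambda_min:
  fixes H :: "'a::euclidean_space \<Rightarrow> 'a"
  assumes lin: "linear H" and sym: "\<And>x y. H x \<bullet> y = x \<bullet> H y"
  shows "lambda_min H * (x \<bullet> x) \<le> H x \<bullet> x"
proof -
  obtain l where l: "l \<in> eigenvalues (\<lambda>x. - H x)" "\<And>x. (- H x) \<bullet> x \<le> l * (x \<bullet> x)"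
    using selfadjoint_maximal_eigenvalue[of "\<lambda>x. - H x"] linear_compose_neg[OF lin] sym
    by (metis inner_minus_left inner_minus_right)
  from l(1) obtain v where v: "v \<noteq> 0" "- H v = l *\<^sub>R v"
    unfolding eigenvalues_def by blast
  have "H v = (- l) *\<^sub>R v"
    using v(2) by (metis minus_minus scaleR_minus_left)
  then have "- l \<in> eigenvalues H"
    unfolding eigenvalues_def using v(1) by blast
  then have "lambda_min H \<le> - l"
    unfolding lambda_min_def by (intro Min_le finite_eigenvalues_selfadjoint sym)
  then have "lambda_min H * (x \<bullet> x) \<le> (- l) * (x \<bullet> x)"
    by (intro mult_right_mono) auto
  with l(2)[of x] show ?thesis by simp
qed

section \<open>Existence and first-order bounds for the conjugate of
  \<open>r_fun \<gamma> g\<close>\<close>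

text \<open>A hyperplane separates the epigraph from the point (x0, t0 - 1) beneath it. It is not
  vertical, hence the graph of an affine minorant.\<close>

lemma convex_fun_affine_minorant:
  fixes g :: "'a::euclidean_space \<Rightarrow> ereal"
  assumes "proper_fun g" "closed_fun g" "convex_fun g"
  obtains a b where "\<And>x t. g x \<le> ereal t \<Longrightarrow> a \<bullet> x + b \<le> t"
proof -
  obtain x0 where "g x0 \<noteq> \<infinity>" "g x0 \<noteq> -\<infinity>"
    using assms(1) unfolding proper_fun_def by blast
  then obtain t0 where t0: "g x0 = ereal t0" by (cases "g x0") auto
  have "(x0, t0 - 1) \<notin> ext_epigraph g"
    unfolding ext_epigraph_def using t0 by simp
  then obtain c b where sep: "c \<bullet> (x0, t0 - 1) < b" "\<And>w. w \<in> ext_epigraph g \<Longrightarrow> c \<bullet> w > b"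
    using separating_hyperplane_closed_point assms(2,3)
    unfolding closed_fun_def convex_fun_def by metis
  obtain a \<alpha> where c: "c = (a, \<alpha>)" by (cases c)
  have epi: "a \<bullet> x + \<alpha> * t > b" if "g x \<le> ereal t" for x t
    using sep(2)[of "(x, t)"] that unfolding ext_epigraph_def c by simp
  \<comment> \<open>(x0, t0) and (x0, t0 - 1) lie on opposite sides and differ only in the last
    coordinate.\<close>
  have "\<alpha> > 0"
    using epi[of x0 t0] sep(1) t0 unfolding c by (simp add: algebra_simps)
  have "(- (1 / \<alpha>) *\<^sub>R a) \<bullet> x + b / \<alpha> \<le> t" if "g x \<le> ereal t" for x t
    using epi[OF that] \<open>\<alpha> > 0\<close> by (simp add: field_simps)
  then show ?thesis using that by blast
qed

lemma conjugate_eqI: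
  assumes le: "\<And>x s. \<phi> x \<le> ereal s \<Longrightarrow> y \<bullet> x - s \<le> c"
    and attained: "\<phi> p \<le> ereal t" "c = y \<bullet> p - t"
  shows "conjugate \<phi> y = ereal c"
  unfolding conjugate_def
proof (rule antisym)
  show "(SUP x. ereal (y \<bullet> x) - \<phi> x) \<le> ereal c"
  proof (rule SUP_least)
    fix x
    show "ereal (y \<bullet> x) - \<phi> x \<le> ereal c"
    proof (cases "\<phi> x")
      case (real r)
      then show ?thesis using le[of x r] by simp
    next
      case MInf
      \<comment> \<open>If \<phi> x = -\<infinity>, every real s is admissible in \<open>le\<close>;
        this one would give c + 1 \<le> c.\<close>
      then show ?thesis using le[of x "y \<bullet> x - c - 1"] by simp
    qed simp
  qed
  have "ereal c \<le> ereal (y \<bullet> p) - \<phi> p"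
    using attained by (cases "\<phi> p") auto
  then show "ereal c \<le> (SUP x. ereal (y \<bullet> x) - \<phi> x)"
    by (rule order_trans) (rule SUP_upper, simp)
qed

lemma r_fun_le_iff:
  assumes "0 < \<gamma>"
  shows "r_fun \<gamma> \<phi> x \<le> ereal s \<longleftrightarrow> \<phi> x \<le> ereal ((s - 1 / 2 * (x \<bullet> x)) / \<gamma>)"
  using assms unfolding r_fun_def
  by (cases "\<phi> x") (auto simp: dot_square_norm pos_le_divide_eq mult.commute[of \<gamma>] le_diff_eq)

text \<open>
  The pair \<open>(p, t)\<close> minimises \<open>\<gamma>s + \<parallel>x\<parallel>\<^sup>2/2 - \<langle>y, x\<rangle>\<close> over the epigraph points \<open>(x, s)\<close>, which keeps
  all arithmetic real; strong convexity in \<open>x\<close> strengthens minimality to quadratic growth.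
\<close>

lemma r_fun_maximizer:
  fixes g :: "'a::euclidean_space \<Rightarrow> ereal"
  assumes g: "proper_fun g" "closed_fun g" "convex_fun g" and \<gamma>: "0 < \<gamma>"
  obtains p t where "g p \<le> ereal t"
    and "\<And>x s. g x \<le> ereal s \<Longrightarrow>
      \<gamma> * t + 1 / 2 * (p \<bullet> p) - y \<bullet> p + 1 / 2 * ((x - p) \<bullet> (x - p))
        \<le> \<gamma> * s + 1 / 2 * (x \<bullet> x) - y \<bullet> x"
proof -
  define J where "J = (\<lambda>w::'a \<times> real. \<gamma> * snd w + 1 / 2 * (fst w \<bullet> fst w) - y \<bullet> fst w)"
  have contJ: "continuous_on S J" for S
    unfolding J_def by (intro continuous_intros)
  obtain a b where ab: "\<And>x t. g x \<le> ereal t \<Longrightarrow> a \<bullet> x + b \<le> t"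
    using convex_fun_affine_minorant[OF g] by blast
  obtain x0 where "g x0 \<noteq> \<infinity>" "g x0 \<noteq> -\<infinity>"
    using g(1) unfolding proper_fun_def by blast
  then obtain t0 where t0: "g x0 = ereal t0" by (cases "g x0") auto
  \<comment> \<open>The minimiser is sought in a sublevel set of J on the epigraph, which contains
    (x0, t0) and will be compact.\<close>
  define c where "c = J (x0, t0)"
  define T where "T = ext_epigraph g \<inter> {w. J w \<le> c}"
  have "closed T"
    unfolding T_def using g(2) contJ
    by (intro closed_Int closed_Collect_le) (auto simp: closed_fun_def)
  moreover have "bounded T"
  proof -
    \<comment> \<open>Inserting t \<ge> <a, x> + b into J \<le> c and completing the square puts x
      in a ball about q. Then t is bounded below by the minorant and above by J \<le> c.\<close>
    define q where "q = y - \<gamma> *\<^sub>R a"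
    define \<rho> where "\<rho> = norm q + sqrt (2 * (c - \<gamma> * b) + q \<bullet> q)"
    define N where "N = norm a * \<rho> + \<bar>b\<bar> + (\<bar>c\<bar> + norm y * \<rho>) / \<gamma>"
    have bd: "w \<in> cball 0 \<rho> \<times> {- N..N}" if "w \<in> T" for w
    proof -
      obtain x t where w: "w = (x, t)" by (cases w)
      have epi: "g x \<le> ereal t" and Jle: "\<gamma> * t + 1 / 2 * (x \<bullet> x) - y \<bullet> x \<le> c"
        using that unfolding T_def ext_epigraph_def w J_def by auto
      have t_ge: "a \<bullet> x + b \<le> t" by (rule ab[OF epi])
      then have "\<gamma> * (a \<bullet> x + b) \<le> \<gamma> * t" using \<gamma> by simp
      then have "(x - q) \<bullet> (x - q) \<le> 2 * (c - \<gamma> * b) + q \<bullet> q"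
        using Jle unfolding q_def
        by (simp add: inner_diff_left inner_diff_right inner_commute algebra_simps)
      then have "norm (x - q) \<le> sqrt (2 * (c - \<gamma> * b) + q \<bullet> q)"
        by (simp add: norm_eq_sqrt_inner)
      then have x: "norm x \<le> \<rho>"
        unfolding \<rho>_def using norm_triangle_sub[of x q] by linarith
      have "- (norm a * \<rho>) \<le> a \<bullet> x"
        using Cauchy_Schwarz_ineq2[of a x] mult_left_mono[OF x norm_ge_zero[of a]] by linarith
      moreover have yx: "y \<bullet> x \<le> norm y * \<rho>"
        using Cauchy_Schwarz_ineq2[of y x] mult_left_mono[OF x norm_ge_zero[of y]] by linarith
      moreover have "0 \<le> (\<bar>c\<bar> + norm y * \<rho>) / \<gamma>"
        using \<gamma> order_trans[OF norm_ge_zero x] by simp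
      moreover have "0 \<le> norm a * \<rho>"
        using order_trans[OF norm_ge_zero x] by simp
      moreover have "\<gamma> * t \<le> \<bar>c\<bar> + norm y * \<rho>"
        using Jle yx inner_ge_zero[of x] by linarith
      then have "t \<le> (\<bar>c\<bar> + norm y * \<rho>) / \<gamma>"
        using \<gamma> by (simp add: field_simps)
      ultimately have "- N \<le> t" "t \<le> N"
        unfolding N_def using t_ge by linarith+
      then show ?thesis using x w by simp
    qed
    show ?thesis
      by (rule bounded_subset[of "cball 0 \<rho> \<times> {- N..N}"]) (use bd in \<open>auto intro!: bounded_Times\<close>)
  qed
  ultimately have "compact T" using compact_eq_bounded_closed by blast
  moreover have "(x0, t0) \<in> T"
    unfolding T_def ext_epigraph_def c_def using t0 by simp
  ultimately obtain P where P: "P \<in> T" "\<And>w. w \<in> T \<Longrightarrow> J P \<le> J w"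
    using continuous_attains_inf[OF _ _ contJ, of T] by blast
  obtain p t where pt: "P = (p, t)" by (cases P)
  have P_epi: "(p, t) \<in> ext_epigraph g" using P(1) unfolding T_def pt by simp
  \<comment> \<open>Outside T the value of J exceeds c, so the minimum over T is global.\<close>
  have min: "J (p, t) \<le> J w" if "w \<in> ext_epigraph g" for w
    using P(2)[of w] P(1) that unfolding T_def pt by (cases "J w \<le> c") auto
  have growth: "\<gamma> * t + 1 / 2 * (p \<bullet> p) - y \<bullet> p + 1 / 2 * ((x - p) \<bullet> (x - p))
        \<le> \<gamma> * s + 1 / 2 * (x \<bullet> x) - y \<bullet> x" if "g x \<le> ereal s" for x s
  proof -
    \<comment> \<open>D is the slope of J at (p, t) towards (x, s); the increment of J along this
      segment is exactly \<theta> (D + \<theta> K / 2).\<close>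
    define D where "D = \<gamma> * (s - t) + (p - y) \<bullet> (x - p)"
    define K where "K = (x - p) \<bullet> (x - p)"
    have "K \<ge> 0" unfolding K_def by simp
    have quad: "0 \<le> D + \<theta> * K / 2" if \<theta>: "0 < \<theta>" "\<theta> \<le> 1" for \<theta>
    proof -
      have "(1 - \<theta>) *\<^sub>R (p, t) + \<theta> *\<^sub>R (x, s) \<in> ext_epigraph g"
        using g(3) P_epi \<open>g x \<le> ereal s\<close> \<theta> unfolding convex_fun_def
        by (intro convexD_alt) (auto simp: ext_epigraph_def)
      then have "0 \<le> J ((1 - \<theta>) *\<^sub>R (p, t) + \<theta> *\<^sub>R (x, s)) - J (p, t)"
        using min by fastforce
      also have "\<dots> = \<theta> * (D + \<theta> * K / 2)"
        unfolding J_def D_def K_def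
        by (simp add: inner_diff_left inner_diff_right inner_add_left inner_add_right
            inner_commute[of x p] inner_commute[of _ y] field_simps)
      finally show ?thesis using \<theta>(1) by (simp add: zero_le_mult_iff)
    qed
    have "D \<ge> 0"
    proof (rule ccontr)
      assume "\<not> D \<ge> 0"
      \<comment> \<open>Chosen so that \<theta> (K + 1) \<le> -D, which makes D + \<theta> K / 2
        negative; the summand 1 covers K = 0.\<close>
      define \<theta> where "\<theta> = min 1 (- D / (K + 1))"
      have "0 < \<theta>" "\<theta> \<le> 1" unfolding \<theta>_def using \<open>\<not> D \<ge> 0\<close> \<open>K \<ge> 0\<close>
        by (auto intro!: divide_neg_pos)
      have "\<theta> * (K + 1) \<le> - D"
        using \<open>K \<ge> 0\<close> unfolding \<theta>_def by (subst pos_le_divide_eq[symmetric]) auto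
      moreover have "0 \<le> \<theta> * K" using \<open>0 < \<theta>\<close> \<open>K \<ge> 0\<close> by simp
      ultimately show False
        using quad[OF \<open>0 < \<theta>\<close> \<open>\<theta> \<le> 1\<close>] \<open>0 < \<theta>\<close> \<open>\<not> D \<ge> 0\<close> by (simp add: algebra_simps)
    qed
    then show ?thesis unfolding D_def
      by (simp add: inner_diff_left inner_diff_right inner_commute algebra_simps)
  qed
  show ?thesis
    using that[of p t] growth P_epi unfolding ext_epigraph_def by blast
qed

text \<open>P y maximises <y, x> - r(x) over x, where r is \<open>r_fun \<gamma> g\<close>. Testing
  P y against the maximum at x gives the lower bound; testing P x against the maximum at y, with the
  quadratic growth retained, gives the upper one.\<close>

lemma conjugate_r_fun_gradient:
  fixes g :: "'a::euclidean_space \<Rightarrow> ereal"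
  assumes g: "proper_fun g" "closed_fun g" "convex_fun g" and \<gamma>: "0 < \<gamma>"
  obtains \<psi> P where "\<And>y. conjugate (r_fun \<gamma> g) y = ereal (\<psi> y)"
    and "\<And>x y. 0 \<le> \<psi> x - \<psi> y - P y \<bullet> (x - y)"
    and "\<And>x y. \<psi> x - \<psi> y - P y \<bullet> (x - y) \<le> 1 / 2 * ((x - y) \<bullet> (x - y))"
proof -
  have "\<exists>p t. g p \<le> ereal t \<and> (\<forall>x s. g x \<le> ereal s \<longrightarrow>
      \<gamma> * t + 1 / 2 * (p \<bullet> p) - y \<bullet> p + 1 / 2 * ((x - p) \<bullet> (x - p))
        \<le> \<gamma> * s + 1 / 2 * (x \<bullet> x) - y \<bullet> x)" for y
    using r_fun_maximizer[OF g \<gamma>, of y] by metis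
  then obtain P T where epi: "\<And>y. g (P y) \<le> ereal (T y)"
    and growth: "\<And>y x s. g x \<le> ereal s \<Longrightarrow>
      \<gamma> * T y + 1 / 2 * (P y \<bullet> P y) - y \<bullet> P y + 1 / 2 * ((x - P y) \<bullet> (x - P y))
        \<le> \<gamma> * s + 1 / 2 * (x \<bullet> x) - y \<bullet> x"
    by metis
  define \<psi> where "\<psi> y = y \<bullet> P y - (\<gamma> * T y + 1 / 2 * (P y \<bullet> P y))" for y
  show ?thesis
  proof (rule that)
    show "conjugate (r_fun \<gamma> g) y = ereal (\<psi> y)" for y
    proof (rule conjugate_eqI)
      show "r_fun \<gamma> g (P y) \<le> ereal (\<gamma> * T y + 1 / 2 * (P y \<bullet> P y))"
        using epi[of y] \<gamma> by (simp add: r_fun_le_iff)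
      show "\<psi> y = y \<bullet> P y - (\<gamma> * T y + 1 / 2 * (P y \<bullet> P y))"
        by (rule \<psi>_def)
      fix x s assume "r_fun \<gamma> g x \<le> ereal s"
      then have "g x \<le> ereal ((s - 1 / 2 * (x \<bullet> x)) / \<gamma>)"
        using \<gamma> by (simp add: r_fun_le_iff)
      moreover have "\<gamma> * ((s - 1 / 2 * (x \<bullet> x)) / \<gamma>) = s - 1 / 2 * (x \<bullet> x)"
        using \<gamma> by simp
      ultimately show "y \<bullet> x - s \<le> \<psi> y"
        using growth[of x "(s - 1 / 2 * (x \<bullet> x)) / \<gamma>" y] inner_ge_zero[of "x - P y"]
        unfolding \<psi>_def by linarith
    qed
    show "0 \<le> \<psi> x - \<psi> y - P y \<bullet> (x - y)" for x y
    proof -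
      have "P y \<bullet> (x - y) = x \<bullet> P y - y \<bullet> P y"
        by (simp add: inner_diff_right inner_commute)
      then show ?thesis
        using growth[OF epi[of y], of x] inner_ge_zero[of "P y - P x"]
        unfolding \<psi>_def by linarith
    qed
    show "\<psi> x - \<psi> y - P y \<bullet> (x - y) \<le> 1 / 2 * ((x - y) \<bullet> (x - y))" for x y
    proof -
      let ?d = "P x - P y"
      have "\<psi> x - \<psi> y - P y \<bullet> (x - y) \<le> (x - y) \<bullet> ?d - 1 / 2 * (?d \<bullet> ?d)"
        using growth[OF epi[of x], of y] unfolding \<psi>_def
        by (simp add: inner_diff_left inner_diff_right inner_commute algebra_simps)
      also have "\<dots> \<le> 1 / 2 * ((x - y) \<bullet> (x - y))"
        using inner_ge_zero[of "(x - y) - ?d"]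
        unfolding inner_diff_left[of "x - y" ?d] inner_diff_right[of _ "x - y" ?d]
          inner_commute[of ?d "x - y"] by linarith
      finally show ?thesis .
    qed
  qed
qed

section \<open>From first-order remainder bounds to smoothness and strong convexity\<close>

lemma GDERIV_if_quadratic_bound:
  assumes "\<And>x. \<bar>\<phi> x - \<phi> y - d \<bullet> (x - y)\<bar> \<le> c * (norm (x - y))\<^sup>2"
  shows "GDERIV \<phi> y :> d"
  unfolding gderiv_def has_derivative_at_within
proof (intro conjI)
  show "bounded_linear (\<lambda>h. h \<bullet> d)" by (rule bounded_linear_inner_left)
  have "((\<lambda>x. (\<phi> x - \<phi> y - d \<bullet> (x - y)) /\<^sub>R norm (x - y)) \<longlongrightarrow> 0) (at y)"
  proof (rule Lim_null_comparison)
    show "\<forall>\<^sub>F x in at y. norm ((\<phi> x - \<phi> y - d \<bullet> (x - y)) /\<^sub>R norm (x - y)) \<le> c * norm (x - y)"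
    proof (rule always_eventually, rule allI)
      fix x
      show "norm ((\<phi> x - \<phi> y - d \<bullet> (x - y)) /\<^sub>R norm (x - y)) \<le> c * norm (x - y)"
        using assms[of x] by (cases "x = y") (auto simp: field_simps power2_eq_square)
    qed
    have "((\<lambda>x. c * norm (x - y)) \<longlongrightarrow> c * norm (y - y)) (at y)"
      by (intro tendsto_intros)
    then show "((\<lambda>x. c * norm (x - y)) \<longlongrightarrow> 0) (at y)" by simp
  qed
  then show "((\<lambda>x. (\<phi> x - \<phi> y - (x - y) \<bullet> d) /\<^sub>R norm (x - y)) \<longlongrightarrow> 0) (at y within UNIV)"
    by (simp add: inner_commute)
qed

text \<open>The two-sided quadratic bound itself shows that \<open>grad\<close> is the gradient, so
  a candidate vector field suffices.\<close>

lemma beta_smoothI: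
  assumes "0 \<le> \<beta>"
    and lower: "\<And>x y. - (\<beta> / 2) * (norm (x - y))\<^sup>2 \<le> \<phi> x - \<phi> y - grad y \<bullet> (x - y)"
    and upper: "\<And>x y. \<phi> x - \<phi> y - grad y \<bullet> (x - y) \<le> (\<beta> / 2) * (norm (x - y))\<^sup>2"
  shows "beta_smooth \<beta> \<phi>"
proof -
  have "GDERIV \<phi> y :> grad y" for y
  proof (rule GDERIV_if_quadratic_bound)
    show "\<bar>\<phi> x - \<phi> y - grad y \<bullet> (x - y)\<bar> \<le> \<beta> / 2 * (norm (x - y))\<^sup>2" for x
      using lower[of x y] upper[of x y] by linarith
  qed
  then show ?thesis unfolding beta_smooth_def using assms by blast
qed

text \<open>After subtracting (\<sigma>/2) ||x||^2 the bound provides a supporting affine function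
  at every point. Averaging the one at the intermediate point z cancels its linear terms.\<close>

lemma strongly_convexI:
  assumes lower: "\<And>x y. (\<sigma> / 2) * (norm (x - y))\<^sup>2 \<le> \<phi> x - \<phi> y - grad y \<bullet> (x - y)"
  shows "strongly_convex \<sigma> \<phi>"
  unfolding strongly_convex_def
proof (rule convex_onI)
  let ?G = "\<lambda>x. \<phi> x - \<sigma> / 2 * (norm x)\<^sup>2"
  have G: "?G y + (grad y - \<sigma> *\<^sub>R y) \<bullet> (x - y) \<le> ?G x" for x y
    using lower[of x y]
    by (simp add: power2_norm_eq_inner inner_diff_left inner_diff_right inner_commute field_simps)
  fix t :: real and x y :: 'a
  assume t: "0 < t" "t < 1"
  define z where "z = (1 - t) *\<^sub>R x + t *\<^sub>R y"
  define v where "v = grad z - \<sigma> *\<^sub>R z"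
  have "(1 - t) * (?G z + v \<bullet> (x - z)) + t * (?G z + v \<bullet> (y - z)) \<le> (1 - t) * ?G x + t * ?G y"
    unfolding v_def using t by (intro add_mono mult_left_mono G) auto
  moreover have "(1 - t) * (c + v \<bullet> (x - z)) + t * (c + v \<bullet> (y - z)) = c" for c
    unfolding z_def by (simp add: inner_diff_right inner_add_right algebra_simps)
  ultimately show "?G ((1 - t) *\<^sub>R x + t *\<^sub>R y) \<le> (1 - t) * ?G x + t * ?G y"
    unfolding z_def[symmetric] by simp
qed auto

section \<open>Resolvents and proximal points\<close>

text \<open>The kernel is trivial, and in finite dimension injectivity gives surjectivity. The lemma
  serves to invert I + \<gamma>H.\<close>

lemma strongly_monotone_inverse:
  fixes N :: "'a::euclidean_space \<Rightarrow> 'a"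
  assumes lin: "linear N" and ge: "\<And>x. x \<bullet> x \<le> N x \<bullet> x"
  obtains S where "linear S" and "\<And>x. N (S x) = x"
proof -
  have "inj N"
  proof (rule linear_injective_0[THEN iffD2, OF lin], intro allI impI)
    fix x assume "N x = 0"
    then show "x = 0" using ge[of x] inner_ge_zero[of x] by (simp add: antisym)
  qed
  then obtain S where "linear S" "N \<circ> S = id"
    using linear_surjective_right_inverse[OF lin] linear_injective_imp_surjective[OF lin] by blast
  then show ?thesis using that by (metis comp_apply id_apply)
qed

text \<open>\<open>arg_min\<close> picks a minimiser by choice; strict minimality pins this choice
  to p.\<close>

lemma prox_eqI:
  assumes "\<And>x. x \<noteq> p \<Longrightarrow> \<phi> p + ereal (1 / (2 * \<gamma>) * (norm (p - z))\<^sup>2)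
                             < \<phi> x + ereal (1 / (2 * \<gamma>) * (norm (x - z))\<^sup>2)"
  shows "prox \<gamma> \<phi> z = p"
  unfolding prox_def arg_min_def is_arg_min_def
proof (rule some_equality)
  show "True \<and> (\<nexists>y. True \<and> \<phi> y + ereal (1 / (2 * \<gamma>) * (norm (y - z))\<^sup>2)
      < \<phi> p + ereal (1 / (2 * \<gamma>) * (norm (p - z))\<^sup>2))"
    using assms by (metis less_asym less_irrefl)
qed (use assms in blast)

section \<open>Quadratic-form bounds behind the two constants\<close>

text \<open>With d = u + \<gamma>Hu and Ad = u - \<gamma>Hu the left side is <Ad, d> + ||Ad||^2. It
  is at most 2 (1 - \<gamma>m) ||u||^2, and Cauchy-Schwarz gives (1 + \<gamma>m) ||u|| \<le>
  ||d||.\<close>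

lemma smoothness_bound:
  fixes H :: "'a::real_inner \<Rightarrow> 'a"
  assumes ge: "m * (u \<bullet> u) \<le> H u \<bullet> u"
    and m: "0 \<le> m" "0 < \<gamma>" "\<gamma> * m \<le> 1"
  shows "2 * (u \<bullet> u) - 2 * \<gamma> * (H u \<bullet> u)
    \<le> 2 * (1 - \<gamma> * m) / (1 + \<gamma> * m)\<^sup>2 * ((u + \<gamma> *\<^sub>R H u) \<bullet> (u + \<gamma> *\<^sub>R H u))"
proof -
  have gu: "\<gamma> * m * (u \<bullet> u) \<le> \<gamma> * (H u \<bullet> u)"
    using mult_left_mono[OF ge, of \<gamma>] m by (simp add: mult.assoc)
  have d: "(1 + \<gamma> * m) * norm u \<le> norm (u + \<gamma> *\<^sub>R H u)"
  proof (cases "u = 0")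
    case False
    have "(1 + \<gamma> * m) * norm u * norm u = u \<bullet> u + \<gamma> * m * (u \<bullet> u)"
      by (simp add: dot_square_norm power2_eq_square algebra_simps)
    also have "\<dots> \<le> (u + \<gamma> *\<^sub>R H u) \<bullet> u"
      using gu by (simp add: inner_add_left)
    also have "\<dots> \<le> norm (u + \<gamma> *\<^sub>R H u) * norm u"
      by (rule norm_cauchy_schwarz)
    finally show ?thesis using False by simp
  qed simp
  have pos: "0 < 1 + \<gamma> * m" using m by (simp add: add_pos_nonneg)
  have "2 * (u \<bullet> u) - 2 * \<gamma> * (H u \<bullet> u) \<le> 2 * (1 - \<gamma> * m) * (u \<bullet> u)"
    using gu by (simp add: algebra_simps)
  also have "\<dots> = 2 * (1 - \<gamma> * m) / (1 + \<gamma> * m)\<^sup>2 * ((1 + \<gamma> * m) * norm u)\<^sup>2"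
    using pos by (simp add: dot_square_norm power_mult_distrib)
  also have "\<dots> \<le> 2 * (1 - \<gamma> * m) / (1 + \<gamma> * m)\<^sup>2 * (norm (u + \<gamma> *\<^sub>R H u))\<^sup>2"
    using m pos d by (intro mult_left_mono power_mono) auto
  finally show ?thesis by (simp add: dot_square_norm)
qed

text \<open>In the same notation the right side is (<Ad, d> - ||Ad||^2) / (2\<gamma>). On an
  eigenvector for \<lambda> the claim says that the concave quadratic (1 -
  \<gamma>\<lambda>)\<lambda> - c (1 + \<gamma>\<lambda>)^2 is nonnegative on [m, L];
  \<open>cm\<close> and \<open>cL\<close> say so at the endpoints, and \<open>prod\<close> stands
  for (\<lambda> - m)(L - \<lambda>) \<ge> 0.\<close>

lemma strong_convexity_bound:
  fixes H :: "'a::real_inner \<Rightarrow> 'a"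
  assumes ge: "m * (u \<bullet> u) \<le> H u \<bullet> u" and le: "H u \<bullet> u \<le> L * (u \<bullet> u)"
    and prod: "H u \<bullet> H u + m * L * (u \<bullet> u) \<le> (m + L) * (H u \<bullet> u)"
    and m: "0 \<le> m" "0 < \<gamma>" "m \<le> L" and c: "0 \<le> c"
    and cm: "c * (1 + \<gamma> * m)\<^sup>2 \<le> (1 - \<gamma> * m) * m" and cL: "c * (1 + \<gamma> * L)\<^sup>2 \<le> (1 - \<gamma> * L) * L"
  shows "c * ((u + \<gamma> *\<^sub>R H u) \<bullet> (u + \<gamma> *\<^sub>R H u)) \<le> H u \<bullet> u - \<gamma> * (H u \<bullet> H u)"
proof -
  define n k e where "n = u \<bullet> u" and "k = H u \<bullet> u" and "e = H u \<bullet> H u"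
  have n: "0 \<le> n" unfolding n_def by simp
  have "0 \<le> k - \<gamma> * e - c * (n + 2 * \<gamma> * k + \<gamma>\<^sup>2 * e)"
  proof (cases "m = L")
    \<comment> \<open>The chord degenerates; the two form bounds pin k to L n, and
      \<open>prod\<close> bounds e by L^2 n.\<close>
    case True
    then have k: "k = L * n" using ge le unfolding n_def k_def by simp
    then have "e \<le> L * L * n"
      using prod True unfolding n_def[symmetric] k_def[symmetric] e_def[symmetric]
      by (simp add: algebra_simps)
    then have "(\<gamma> + c * \<gamma>\<^sup>2) * e \<le> (\<gamma> + c * \<gamma>\<^sup>2) * (L * L * n)"
      using m c by (intro mult_left_mono) auto
    moreover have "0 \<le> ((1 - \<gamma> * L) * L - c * (1 + \<gamma> * L)\<^sup>2) * n"
      using cL n by simp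
    ultimately show ?thesis unfolding k by (simp add: power2_eq_square algebra_simps)
  next
    case False
    then have "0 < L - m" using m by simp
    define qm qL where "qm = (1 - \<gamma> * m) * m - c * (1 + \<gamma> * m)\<^sup>2"
      and "qL = (1 - \<gamma> * L) * L - c * (1 + \<gamma> * L)\<^sup>2"
    have "0 \<le> (L - m) * ((\<gamma> + c * \<gamma>\<^sup>2) * ((m + L) * k - e - m * L * n))
        + qL * (k - m * n) + qm * (L * n - k)"
      using \<open>0 < L - m\<close> cm cL m c ge le prod
      unfolding n_def k_def e_def qm_def qL_def
      by (intro add_nonneg_nonneg mult_nonneg_nonneg) auto
    \<comment> \<open>a concave quadratic is its chord plus a nonnegative multiple of \<open>(\<lambda> - m)(L - \<lambda>)\<close>\<close>
    also have "\<dots> = (L - m) * (k - \<gamma> * e - c * (n + 2 * \<gamma> * k + \<gamma>\<^sup>2 * e))"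
      unfolding qm_def qL_def by (simp add: power2_eq_square algebra_simps)
    finally show ?thesis using \<open>0 < L - m\<close> by (simp add: zero_le_mult_iff)
  qed
  moreover have "(u + \<gamma> *\<^sub>R H u) \<bullet> (u + \<gamma> *\<^sub>R H u) = n + 2 * \<gamma> * k + \<gamma>\<^sup>2 * e"
    unfolding n_def k_def e_def
    by (simp add: inner_add_left inner_add_right inner_commute power2_eq_square algebra_simps)
  ultimately show ?thesis by (simp add: k_def e_def)
qed

theorem proposition4p6:
  fixes H :: "'a::euclidean_space \<Rightarrow> 'a" and h :: 'a
    and f :: "'a \<Rightarrow> real" and g :: "'a \<Rightarrow> ereal"
    and \<gamma> L m :: real
  assumes "linear H" and "adjoint H = H"
    and "\<And>x. f x = 1 / 2 * (H x \<bullet> x) + h \<bullet> x"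
    and "proper_fun g" and "closed_fun g" and "convex_fun g"
    and "L = lambda_max H" and "m = lambda_min H" and "0 \<le> m"
    and "0 < \<gamma>" and "L \<noteq> 0 \<Longrightarrow> \<gamma> < 1 / L"
  shows "\<exists>F :: 'a \<Rightarrow> real.
           (\<forall>z. DR_envelope \<gamma> (\<lambda>x. ereal (f x)) g z = ereal (F z)) \<and>
           beta_smooth ((1 - \<gamma> * m) / (1 + \<gamma> * m)\<^sup>2 * inverse \<gamma>) F \<and>
           strongly_convex (min ((1 - \<gamma> * m) * m / (1 + \<gamma> * m)\<^sup>2)
                                ((1 - \<gamma> * L) * L / (1 + \<gamma> * L)\<^sup>2)) F"
proof -
  note lin = \<open>linear H\<close> and f = assms(3) and g = assms(4-6) and \<gamma> = \<open>0 < \<gamma>\<close>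
  have sym: "H x \<bullet> y = x \<bullet> H y" for x y
    using adjoint_works[OF lin, of x y] \<open>adjoint H = H\<close> by (simp add: inner_commute)
  have ge: "m * (x \<bullet> x) \<le> H x \<bullet> x" for x
    using selfadjoint_ge_lambda_min[OF lin sym] \<open>m = lambda_min H\<close> by simp
  have le: "H x \<bullet> x \<le> L * (x \<bullet> x)" for x
    using selfadjoint_le_lambda_max[OF lin sym] \<open>L = lambda_max H\<close> by simp
  have psd: "0 \<le> H x \<bullet> x" for x
    using ge[of x] mult_nonneg_nonneg[OF \<open>0 \<le> m\<close> inner_ge_zero[of x]] by linarith
  \<comment> \<open>A unit vector turns the two form bounds into m \<le> L.\<close>
  obtain b :: 'a where b: "b \<in> Basis" using nonempty_Basis by blast
  have mL: "m \<le> L" using ge[of b] le[of b] b by simp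
  \<comment> \<open>For L = 0 the product is 0, in line with \<gamma> ranging over all positive
    reals.\<close>
  have \<gamma>L: "\<gamma> * L < 1"
    using assms(11) mL \<open>0 \<le> m\<close> by (cases "L = 0") (auto simp: field_simps)
  have \<gamma>m: "\<gamma> * m \<le> 1"
    using mult_left_mono[OF mL, of \<gamma>] \<gamma> \<gamma>L by linarith

  \<comment> \<open>The proximal map and the conjugate for the quadratic f\<close>
  let ?N = "\<lambda>x. x + \<gamma> *\<^sub>R H x"
  have linN: "linear ?N"
    by (intro linear_compose_add lin linear_compose_scale_right linear_id[unfolded id_def])
  have Nge: "x \<bullet> x \<le> ?N x \<bullet> x" for x
    using psd[of x] \<gamma> by (simp add: inner_add_left)
  \<comment> \<open>S is the resolvent (I + \<gamma>H)^{-1}; it inherits self-adjointness from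
    H.\<close>
  obtain S where linS: "linear S" and NS: "\<And>x. S x + \<gamma> *\<^sub>R H (S x) = x"
    using strongly_monotone_inverse[OF linN Nge] by blast
  have symS: "S x \<bullet> y = x \<bullet> S y" for x y
  proof -
    have "S x \<bullet> y = S x \<bullet> ?N (S y)" by (simp add: NS)
    also have "\<dots> = ?N (S x) \<bullet> S y"
      by (simp add: inner_add_left inner_add_right sym)
    finally show ?thesis by (simp add: NS)
  qed

  \<comment> \<open>Solution of the stationarity condition p + \<gamma>(Hp + h) = z of the prox
    objective.\<close>
  define p where "p z = S (z - \<gamma> *\<^sub>R h)" for z
  have z_eq: "z = p z + \<gamma> *\<^sub>R H (p z) + \<gamma> *\<^sub>R h" for z
    using NS[of "z - \<gamma> *\<^sub>R h"] unfolding p_def by (simp add: algebra_simps)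
  \<comment> \<open>Exact second-order expansion about p z, with linear term zero by
    \<open>z_eq\<close>. It yields both the prox and the conjugate of f.\<close>
  have quad: "\<gamma> * f x + 1 / 2 * (x \<bullet> x) - z \<bullet> x
      = \<gamma> * f (p z) + 1 / 2 * (p z \<bullet> p z) - z \<bullet> p z + 1 / 2 * (?N (x - p z) \<bullet> (x - p z))" for x z
  proof -
    define q v where "q = p z" and "v = x - q"
    have z: "z = q + \<gamma> *\<^sub>R H q + \<gamma> *\<^sub>R h"
      unfolding q_def by (rule z_eq)
    have x: "x = q + v"
      by (simp add: v_def)
    have "H v \<bullet> q = H q \<bullet> v"
      using sym[of v q] by (simp add: inner_commute)
    then have "\<gamma> * f x + 1 / 2 * (x \<bullet> x) - z \<bullet> x
        = \<gamma> * f q + 1 / 2 * (q \<bullet> q) - z \<bullet> q + 1 / 2 * (?N v \<bullet> v)"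
      unfolding x z
      by (simp add: f linear_add[OF lin] inner_add_left inner_add_right
          inner_commute[of v q] field_simps)
    then show ?thesis by (simp only: q_def v_def)
  qed
  have prox: "prox \<gamma> (\<lambda>x. ereal (f x)) z = p z" for z
  proof (rule prox_eqI)
    fix x assume "x \<noteq> p z"
    then have "0 < (x - p z) \<bullet> (x - p z)" by simp
    then have "\<gamma> * f (p z) + 1 / 2 * (p z \<bullet> p z) - z \<bullet> p z < \<gamma> * f x + 1 / 2 * (x \<bullet> x) - z \<bullet> x"
      using quad[of x z] Nge[of "x - p z"] by linarith
    then have "\<gamma> * f (p z) + 1 / 2 * (norm (p z - z))\<^sup>2 < \<gamma> * f x + 1 / 2 * (norm (x - z))\<^sup>2"
      by (simp add: power2_norm_eq_inner inner_diff_left inner_diff_right inner_commute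
          add_divide_distrib diff_divide_distrib)
    then have "(\<gamma> * f (p z) + 1 / 2 * (norm (p z - z))\<^sup>2) / \<gamma> < (\<gamma> * f x + 1 / 2 * (norm (x - z))\<^sup>2) / \<gamma>"
      using \<gamma> by (rule divide_strict_right_mono)
    then have "f (p z) + 1 / (2 * \<gamma>) * (norm (p z - z))\<^sup>2 < f x + 1 / (2 * \<gamma>) * (norm (x - z))\<^sup>2"
      using \<gamma> by (simp add: add_divide_distrib)
    then show "ereal (f (p z)) + ereal (1 / (2 * \<gamma>) * (norm (p z - z))\<^sup>2)
             < ereal (f x) + ereal (1 / (2 * \<gamma>) * (norm (x - z))\<^sup>2)"
      by simp
  qed
  have conj_f: "conjugate (r_fun \<gamma> (\<lambda>x. ereal (f x))) z = ereal (1 / 2 * ((z - \<gamma> *\<^sub>R h) \<bullet> p z))" for z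
  proof (rule conjugate_eqI)
    show "r_fun \<gamma> (\<lambda>x. ereal (f x)) (p z) \<le> ereal (\<gamma> * f (p z) + 1 / 2 * (p z \<bullet> p z))"
      using \<gamma> by (simp add: r_fun_le_iff)
    \<comment> \<open>Pairing the stationarity equation with p z collapses the maximal value to half
      an inner product.\<close>
    have "z \<bullet> p z = (p z + \<gamma> *\<^sub>R H (p z) + \<gamma> *\<^sub>R h) \<bullet> p z"
      by (rule arg_cong[OF z_eq[of z], of "\<lambda>w. w \<bullet> p z"])
    then show val: "1 / 2 * ((z - \<gamma> *\<^sub>R h) \<bullet> p z) = z \<bullet> p z - (\<gamma> * f (p z) + 1 / 2 * (p z \<bullet> p z))"
      by (simp add: f inner_add_left inner_diff_left field_simps)
    fix x s assume "r_fun \<gamma> (\<lambda>x. ereal (f x)) x \<le> ereal s"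
    then have "\<gamma> * f x + 1 / 2 * (x \<bullet> x) \<le> s"
      using \<gamma> by (simp add: r_fun_le_iff field_simps)
    then show "z \<bullet> x - s \<le> 1 / 2 * ((z - \<gamma> *\<^sub>R h) \<bullet> p z)"
      unfolding val using quad[of x z] Nge[of "x - p z"] inner_ge_zero[of "x - p z"] by linarith
  qed

  \<comment> \<open>The real-valued envelope and its exact first-order remainder\<close>
  obtain \<psi> P where \<psi>: "\<And>y. conjugate (r_fun \<gamma> g) y = ereal (\<psi> y)"
    and \<psi>_lower: "\<And>x y. 0 \<le> \<psi> x - \<psi> y - P y \<bullet> (x - y)"
    and \<psi>_upper: "\<And>x y. \<psi> x - \<psi> y - P y \<bullet> (x - y) \<le> 1 / 2 * ((x - y) \<bullet> (x - y))"
    using conjugate_r_fun_gradient[OF g \<gamma>] by blast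

  define R where "R z = 2 *\<^sub>R p z - z" for z
  define A where "A w = 2 *\<^sub>R S w - w" for w
  define Q where "Q z = R z \<bullet> z - ((z - \<gamma> *\<^sub>R h) \<bullet> p z - 1 / 2 * (z \<bullet> z))" for z
  define F where "F z = 1 / (2 * \<gamma>) * (Q z - (2 * \<psi> (R z) - 1 / 2 * (R z \<bullet> R z)))" for z
  \<comment> \<open>Suggested by the chain rule: Q has gradient A z, the function p^2 of g has
    gradient 2P - I, and R has self-adjoint linear part A.\<close>
  define grad where "grad z = (1 / (2 * \<gamma>)) *\<^sub>R A (z - (2 *\<^sub>R P (R z) - R z))" for z

  have envelope: "DR_envelope \<gamma> (\<lambda>x. ereal (f x)) g z = ereal (F z)" for z
    unfolding DR_envelope_def refl_prox_def prox p_sq_def conj_f \<psi> F_def Q_def R_def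
    by (simp add: power2_norm_eq_inner)

  \<comment> \<open>Everything in F except \<psi> is quadratic, so the only inexplicit term is the
    remainder of \<psi> at R y for the displacement A (x - y).\<close>
  have remainder: "F x - F y - grad y \<bullet> (x - y) = 1 / (2 * \<gamma>) *
      (1 / 2 * ((x - y) \<bullet> A (x - y)) + 1 / 2 * (A (x - y) \<bullet> A (x - y))
        - 2 * (\<psi> (R x) - \<psi> (R y) - P (R y) \<bullet> (R x - R y)))"
    and R_diff: "R x - R y = A (x - y)" for x y
  proof -
    define d where "d = x - y"
    have x: "x = y + d" by (simp add: d_def)
    have px: "p x = p y + S d"
      unfolding p_def x by (simp add: linear_diff[OF linS] linear_add[OF linS])
    have Rx: "R x = R y + A d"
      unfolding R_def A_def px unfolding x by (simp add: algebra_simps)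
    then show "R x - R y = A (x - y)" by (simp add: d_def)
    \<comment> \<open>Moving S across the inner product lets the cross terms of Q combine into <y, A
      d>.\<close>
    have "d \<bullet> p y = (y - \<gamma> *\<^sub>R h) \<bullet> S d"
      unfolding p_def using symS[of "y - \<gamma> *\<^sub>R h" d] by (simp add: inner_commute)
    then have Q: "Q x - Q y = y \<bullet> A d + 1 / 2 * (d \<bullet> A d)"
      unfolding Q_def R_def A_def px unfolding x
      by (simp add: inner_add_left inner_add_right inner_diff_left inner_diff_right
          inner_commute algebra_simps)
    have "A w \<bullet> d = w \<bullet> A d" for w
      unfolding A_def by (simp add: inner_diff_left inner_diff_right symS)
    then have "grad y \<bullet> d = 1 / (2 * \<gamma>) * ((y - (2 *\<^sub>R P (R y) - R y)) \<bullet> A d)"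
      unfolding grad_def by simp
    moreover have "F x - F y = 1 / (2 * \<gamma>) * (Q x - Q y - 2 * (\<psi> (R x) - \<psi> (R y))
        + 1 / 2 * (R x \<bullet> R x - R y \<bullet> R y))"
      unfolding F_def by (simp add: algebra_simps)
    ultimately have "F x - F y - grad y \<bullet> d = 1 / (2 * \<gamma>) * (Q x - Q y - 2 * (\<psi> (R x) - \<psi> (R y))
        + 1 / 2 * (R x \<bullet> R x - R y \<bullet> R y) - (y - (2 *\<^sub>R P (R y) - R y)) \<bullet> A d)"
      by (simp only: right_diff_distrib)
    also have "Q x - Q y - 2 * (\<psi> (R x) - \<psi> (R y))
        + 1 / 2 * (R x \<bullet> R x - R y \<bullet> R y) - (y - (2 *\<^sub>R P (R y) - R y)) \<bullet> A d
      = 1 / 2 * (d \<bullet> A d) + 1 / 2 * (A d \<bullet> A d)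
        - 2 * (\<psi> (R x) - \<psi> (R y) - P (R y) \<bullet> A d)"
      unfolding Q
      by (simp add: Rx inner_add_left inner_add_right inner_diff_left inner_diff_right
          inner_commute algebra_simps)
    finally show "F x - F y - grad y \<bullet> (x - y) = 1 / (2 * \<gamma>) *
      (1 / 2 * ((x - y) \<bullet> A (x - y)) + 1 / 2 * (A (x - y) \<bullet> A (x - y))
        - 2 * (\<psi> (R x) - \<psi> (R y) - P (R y) \<bullet> (R x - R y)))"
      using Rx by (simp add: d_def)
  qed

  \<comment> \<open>Comparing the remainder with the two constants\<close>
  define \<beta> where "\<beta> = (1 - \<gamma> * m) / (1 + \<gamma> * m)\<^sup>2 * inverse \<gamma>"
  define \<sigma> where "\<sigma> = min ((1 - \<gamma> * m) * m / (1 + \<gamma> * m)\<^sup>2) ((1 - \<gamma> * L) * L / (1 + \<gamma> * L)\<^sup>2)"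
  have \<beta>: "0 \<le> \<beta>" unfolding \<beta>_def using \<gamma>m \<gamma> by simp
  have \<sigma>: "0 \<le> \<sigma>" unfolding \<sigma>_def using \<gamma>m \<gamma>L mL \<open>0 \<le> m\<close> by simp
  have pos: "0 < (1 + \<gamma> * m)\<^sup>2" "0 < (1 + \<gamma> * L)\<^sup>2"
    using \<gamma> mL \<open>0 \<le> m\<close> by (intro zero_less_power add_pos_nonneg mult_nonneg_nonneg; simp)+
  have \<sigma>m: "\<sigma> * (1 + \<gamma> * m)\<^sup>2 \<le> (1 - \<gamma> * m) * m" and \<sigma>L: "\<sigma> * (1 + \<gamma> * L)\<^sup>2 \<le> (1 - \<gamma> * L) * L"
    using pos unfolding pos_le_divide_eq[symmetric, OF pos(1)] pos_le_divide_eq[symmetric, OF pos(2)]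
    by (simp_all add: \<sigma>_def)

  have upper: "F x - F y - grad y \<bullet> (x - y) \<le> \<beta> / 2 * (norm (x - y))\<^sup>2" for x y
  proof -
    define u where "u = S (x - y)"
    have d: "x - y = u + \<gamma> *\<^sub>R H u" unfolding u_def by (simp add: NS)
    have A: "A (x - y) = u - \<gamma> *\<^sub>R H u"
      unfolding A_def u_def[symmetric] unfolding d by (simp add: scaleR_2)
    \<comment> \<open>The remainder of \<psi> is nonnegative and enters with a minus sign, so
      dropping it gives an upper bound.\<close>
    have "F x - F y - grad y \<bullet> (x - y)
        \<le> 1 / (2 * \<gamma>) * (1 / 2 * ((x - y) \<bullet> A (x - y)) + 1 / 2 * (A (x - y) \<bullet> A (x - y)))"
      unfolding remainder using \<gamma> \<psi>_lower[of "R x" "R y"] by (intro mult_left_mono) auto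
    also have "\<dots> = 1 / (4 * \<gamma>) * (2 * (u \<bullet> u) - 2 * \<gamma> * (H u \<bullet> u))"
      unfolding A unfolding d
      by (simp add: inner_add_left inner_add_right inner_diff_left inner_diff_right
          inner_commute field_simps)
    also have "\<dots> \<le> 1 / (4 * \<gamma>) * (2 * (1 - \<gamma> * m) / (1 + \<gamma> * m)\<^sup>2 * ((x - y) \<bullet> (x - y)))"
      unfolding d using \<gamma> \<gamma>m ge \<open>0 \<le> m\<close> by (intro mult_left_mono smoothness_bound) auto
    also have "\<dots> = \<beta> / 2 * (norm (x - y))\<^sup>2"
    proof -
      have "1 / (4 * \<gamma>) * (2 * a / q * n) = a / q * inverse \<gamma> / 2 * n" for a q n
        by (simp add: inverse_eq_divide mult.commute)
      then show ?thesis
        unfolding \<beta>_def power2_norm_eq_inner by blast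
    qed
    finally show ?thesis .
  qed
  have lower: "\<sigma> / 2 * (norm (x - y))\<^sup>2 \<le> F x - F y - grad y \<bullet> (x - y)" for x y
  proof -
    define u where "u = S (x - y)"
    have d: "x - y = u + \<gamma> *\<^sub>R H u" unfolding u_def by (simp add: NS)
    have A: "A (x - y) = u - \<gamma> *\<^sub>R H u"
      unfolding A_def u_def[symmetric] unfolding d by (simp add: scaleR_2)
    have "\<sigma> / 2 * (norm (x - y))\<^sup>2 = 1 / 2 * (\<sigma> * ((u + \<gamma> *\<^sub>R H u) \<bullet> (u + \<gamma> *\<^sub>R H u)))"
      unfolding power2_norm_eq_inner d by simp
    also have "\<dots> \<le> 1 / 2 * (H u \<bullet> u - \<gamma> * (H u \<bullet> H u))"
      by (intro mult_left_mono strong_convexity_bound[where m = m and L = L] ge le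
          selfadjoint_product_nonneg[OF lin sym ge le] \<gamma> mL \<open>0 \<le> m\<close> \<sigma> \<sigma>m \<sigma>L) simp
    also have "\<dots> = 1 / (2 * \<gamma>) * (1 / 2 * ((x - y) \<bullet> A (x - y)) - 1 / 2 * (A (x - y) \<bullet> A (x - y)))"
      unfolding A unfolding d using \<gamma>
      by (simp add: inner_add_left inner_add_right inner_diff_left inner_diff_right
          inner_commute field_simps)
    \<comment> \<open>The remainder of \<psi> is at most ||A(x - y)||^2 / 2; subtracting twice this
      turns the coefficient 1/2 of ||A(x - y)||^2 into -1/2.\<close>
    also have "\<dots> \<le> F x - F y - grad y \<bullet> (x - y)"
      unfolding remainder using \<gamma> \<psi>_upper[of "R x" "R y"] unfolding R_diff
      by (intro mult_left_mono) auto
    finally show ?thesis .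
  qed

  have "beta_smooth \<beta> F"
  proof (rule beta_smoothI[OF \<beta> _ upper])
    fix x y :: 'a
    \<comment> \<open>As \<sigma> \<ge> 0, the strong convexity bound already makes the remainder
      nonnegative, hence the lower half of smoothness.\<close>
    have "- (\<beta> / 2) * (norm (x - y))\<^sup>2 \<le> 0" and "0 \<le> \<sigma> / 2 * (norm (x - y))\<^sup>2"
      using \<beta> \<sigma> by simp_all
    then show "- (\<beta> / 2) * (norm (x - y))\<^sup>2 \<le> F x - F y - grad y \<bullet> (x - y)"
      using lower[of x y] by linarith
  qed
  moreover have "strongly_convex \<sigma> F" by (rule strongly_convexI[OF lower])
  ultimately show ?thesis using envelope unfolding \<beta>_def \<sigma>_def by blast
qed

end
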